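(* There are real constants $c_k$ (one for each prime $k$) with $c_k \to 1$ as $k \to \infty$ such that for every positive integer $n$ and every prime $k$, $$ n^{1-\frac{c_k}{k \ln k}} < r_k(n). $$
   Context: A $k$-term arithmetic progression ($k$-AP) is a sequence $a, a+d, a+2d, \dots, a+(k-1)d$ of integers with common difference $d \ge 1$. For positive integers $k, n$, $r_k(n)$ denotes the maximum cardinality of a set $A \subseteq \{1,2,\dots,n\}$ that contains no $k$-AP. (In the paper the constant is $c_k = \ln\left(\left(\tfrac{k}{k-1}\right)^k\right) = k\ln\frac{k}{k-1}$.)
   Formalization: The bound is stated for every integer n ≥ 2 instead of every positive integer n: at n = 1 both sides equal 1, so the strict inequality fails there for every choice of the constants. *)

theory Defs
  imports Complex_Main "HOL-Computational_Algebra.Primes"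
begin

definition arith_prog :: "nat \<Rightarrow> int \<Rightarrow> int \<Rightarrow> int set" where
  "arith_prog k a d = (\<lambda>i. a + int i * d) ` {..<k}"

definition ap_free :: "nat \<Rightarrow> int set \<Rightarrow> bool" where
  "ap_free k A \<longleftrightarrow> \<not> (\<exists>a d. d \<ge> 1 \<and> arith_prog k a d \<subseteq> A)"

(* For k > 0 the empty set is k-AP-free, so the maximum is over a nonempty finite set;
   for k = 0 that set is empty and the value is unspecified. *)
definition r :: "nat \<Rightarrow> nat \<Rightarrow> nat" where
  "r k n = Max (card ` {A. A \<subseteq> {1..int n} \<and> ap_free k A})"

(* Since 1 powr e = 1 for every exponent e, a strict bound n powr e < r k n
   cannot hold at n = 1. *)
lemma r_one:
  assumes "k \<ge> 2"
  shows "r k 1 = 1"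
proof -
  have free: "ap_free k A" if "A \<subseteq> {1}" for A
    unfolding ap_free_def
  proof (intro notI, elim exE conjE)
    fix a d :: int
    assume d: "d \<ge> 1" and sub: "arith_prog k a d \<subseteq> A"
    have "a + int 0 * d \<in> arith_prog k a d" "a + int 1 * d \<in> arith_prog k a d"
      using assms unfolding arith_prog_def by (intro imageI; simp)+
    then have "a = 1" "a + d = 1"
      using sub that by auto
    with d show False by simp
  qed
  have "{A. A \<subseteq> {1..int 1} \<and> ap_free k A} = {{}, {1}}"
    using free by (auto simp: subset_singleton_iff)
  then show ?thesis
    by (simp add: r_def)
qed

end

theory Submission
  imports Defs "HOL-Number_Theory.Cong" "HOL-Real_Asymp.Real_Asymp"
begin

text \<open>Let S be the set of natural numbers without the digit k - 1 in base k. If d = k^v e with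
  e coprime to the prime k, then the v-th digit runs through all residues along a k-term
  progression of difference d, so S contains none. Put \<alpha> = log_k (k - 1), so that
  (k x)^\<alpha> = (k - 1) x^\<alpha>. Self-similarity of S gives card (S \<inter> [0, n)) \<ge> n^\<alpha> for every n, not only
  for powers of k. For n \<ge> 2, lowering the exponent slightly makes the bound strict;
  \<alpha> = 1 - k ln (k / (k - 1)) / (k ln k), which leaves room for a perturbation 1 / k of the
  constant.\<close>

text \<open>Letting \<open>i\<close> range over all positions avoids digit lists: the leading zeros
  are harmless once k \<ge> 2, as then k - 1 is not 0.\<close>

definition no_top_digit :: "nat \<Rightarrow> nat set" where
  "no_top_digit k = {x. \<forall>i. (x div k ^ i) mod k \<noteq> k - 1}"

lemma no_top_digit_iff:
  "x \<in> no_top_digit k \<longleftrightarrow> x mod k \<noteq> k - 1 \<and> x div k \<in> no_top_digit k"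
proof -
  have "(\<forall>i. P i) \<longleftrightarrow> P 0 \<and> (\<forall>i. P (Suc i))" for P :: "nat \<Rightarrow> bool"
    by (metis not0_implies_Suc)
  from this[of "\<lambda>i. (x div k ^ i) mod k \<noteq> k - 1"] show ?thesis
    by (simp add: no_top_digit_def div_mult2_eq)
qed

lemma zero_in_no_top_digit: "k \<ge> 2 \<Longrightarrow> 0 \<in> no_top_digit k"
  by (simp add: no_top_digit_def)

text \<open>Induction on \<open>d\<close>. If \<open>k\<close> divides \<open>d\<close>, deleting
  the last digit of every term leaves a progression of difference d / k. Otherwise \<open>d\<close>
  is invertible modulo \<open>k\<close>, and some term ends in the digit k - 1.\<close>

lemma no_top_digit_no_progression:
  assumes "prime k" "d > 0"
  shows "\<exists>i<k. a + i * d \<notin> no_top_digit k"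
  using assms(2)
proof (induction d arbitrary: a rule: less_induct)
  case (less d)
  have k: "k \<ge> 2" using assms(1) by (rule prime_ge_2_nat)
  show ?case
  proof (cases "k dvd d")
    case True
    then obtain e where e: "d = k * e" by blast
    with less.prems k have "e > 0" "e < d" by auto
    then obtain i where i: "i < k" "a div k + i * e \<notin> no_top_digit k"
      using less.IH by blast
    have "a + i * d = k * (i * e) + a" by (simp add: e)
    then have "(a + i * d) div k = a div k + i * e"
      using k by (simp only: div_mult_self4)
    with i show ?thesis by (metis no_top_digit_iff)
  next
    case False
    then have "coprime d k"
      using prime_imp_coprime[OF assms(1)] by (metis coprime_commute)
    then obtain x where x: "[d * x = 1] (mod k)"
      using cong_solve_coprime_nat by auto
    \<comment> \<open>\<open>b\<close> is congruent to -1 - a modulo \<open>k\<close>, written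
      without negative numbers; \<open>x\<close> inverts \<open>d\<close>, so \<open>i\<close>
      solves a + i d = -1 modulo \<open>k\<close>.\<close>
    define b where "b = (k - 1) + (k - 1) * a"
    define i where "i = (x * b) mod k"
    have "[i = x * b] (mod k)" by (simp add: i_def cong_def)
    then have "[a + i * d = a + (x * b) * d] (mod k)"
      by (intro cong_add cong_mult cong_refl)
    also have "a + (x * b) * d = a + (d * x) * b" by (simp add: mult_ac)
    also have "[a + (d * x) * b = a + 1 * b] (mod k)"
      by (intro cong_add cong_mult cong_refl x)
    also have "a + 1 * b = (k - 1) + k * a"
      using k by (cases k) (auto simp: b_def)
    finally have "(a + i * d) mod k = (k - 1 + k * a) mod k"
      unfolding Cong.cong_def .
    also have "\<dots> = (k - 1) mod k" by (rule mod_mult_self2)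
    also have "\<dots> = k - 1" using k by simp
    finally have "(a + i * d) mod k = k - 1" .
    moreover have "i < k" using k by (simp add: i_def)
    ultimately show ?thesis by (metis no_top_digit_iff)
  qed
qed

text \<open>Appending any of the k - 1 allowed last digits to a member below \<open>q\<close> gives
  distinct members below k q.\<close>

lemma card_no_top_digit_mult:
  assumes "k \<ge> 2"
  shows "(k - 1) * card (no_top_digit k \<inter> {..<q}) \<le> card (no_top_digit k \<inter> {..<k * q})"
proof -
  let ?D = "(no_top_digit k \<inter> {..<q}) \<times> {..<k - 1}"
  let ?h = "\<lambda>(y, t). k * y + t"
  have digit: "(k * y + t) mod k = t" "(k * y + t) div k = y" if "t < k - 1" for y t
    using that by auto
  have "inj_on ?h ?D"
    by (rule inj_on_inverseI[where g = "\<lambda>x. (x div k, x mod k)"])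
      (auto simp del: div_mult_self1 div_mult_self2 simp: digit)
  moreover have "?h ` ?D \<subseteq> no_top_digit k \<inter> {..<k * q}"
  proof (rule image_subsetI)
    fix p assume "p \<in> ?D"
    then obtain y t where p: "p = (y, t)" and yt: "y \<in> no_top_digit k" "y < q" "t < k - 1"
      by auto
    from yt have "k * Suc y \<le> k * q" by (intro mult_le_mono2) simp
    with yt have "k * y + t < k * q" by simp
    moreover have "k * y + t \<in> no_top_digit k"
      using yt by (subst no_top_digit_iff) (simp add: digit)
    ultimately show "?h p \<in> no_top_digit k \<inter> {..<k * q}" by (simp add: p)
  qed
  ultimately have "card ?D \<le> card (no_top_digit k \<inter> {..<k * q})"
    by (metis card_image card_mono finite_Int finite_lessThan)
  then show ?thesis by (simp add: card_cartesian_product mult.commute)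
qed

text \<open>Write t^\<alpha> as t * t^(\<alpha> - 1); the second factor does not increase with
  t.\<close>

lemma powr_Suc_le:
  assumes "0 \<le> \<alpha>" "\<alpha> \<le> 1"
  shows "real (Suc n) powr \<alpha> \<le> real n powr \<alpha> + 1"
proof (cases "n = 0")
  case False
  have "real (Suc n) powr \<alpha> = real (Suc n) * real (Suc n) powr (\<alpha> - 1)"
    by (simp add: powr_diff)
  also have "\<dots> = real n * real (Suc n) powr (\<alpha> - 1) + real (Suc n) powr (\<alpha> - 1)"
    by (simp add: algebra_simps)
  also have "\<dots> \<le> real n * real n powr (\<alpha> - 1) + real 1 powr (\<alpha> - 1)"
    using assms False by (intro add_mono mult_left_mono powr_mono2') auto
  also have "\<dots> = real n powr \<alpha> + 1"
    using False by (simp add: powr_diff)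
  finally show ?thesis .
qed simp

text \<open>Strong induction on n = m + 1. If \<open>m\<close> is a member, the count grows by 1 and
  the power by at most 1. Otherwise the bound at m div k + 1 is scaled up by
  \<open>k\<close>.\<close>

lemma card_no_top_digit_ge:
  assumes k: "k \<ge> 2"
  shows "real n powr log (real k) (real k - 1) \<le> real (card (no_top_digit k \<inter> {..<n}))"
proof (induction n rule: less_induct)
  case (less n)
  let ?f = "\<lambda>n. card (no_top_digit k \<inter> {..<n})"
  define \<alpha> where "\<alpha> = log (real k) (real k - 1)"
  have \<alpha>: "0 \<le> \<alpha>" "\<alpha> \<le> 1" using k by (auto simp: \<alpha>_def)
  have k_powr: "real k powr \<alpha> = real k - 1" using k by (simp add: \<alpha>_def)
  have f_mono: "?f a \<le> ?f b" if "a \<le> b" for a b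
    using that by (intro card_mono) auto
  show ?case
  proof (cases n)
    case (Suc m)
    show ?thesis
    proof (cases "m \<in> no_top_digit k")
      case True
      then have "?f n = Suc (?f m)"
        by (simp add: Suc lessThan_Suc)
      moreover have "real m powr \<alpha> \<le> real (?f m)"
        using less.IH[of m] Suc by (simp add: \<alpha>_def)
      ultimately show ?thesis
        using powr_Suc_le[OF \<alpha>, of m] Suc by (simp add: \<alpha>_def)
    next
      case False
      define q where "q = m div k"
      have m: "m = k * q + m mod k" by (simp add: q_def)
      \<comment> \<open>For m = 0 the induction hypothesis would be applied to \<open>n\<close>
        itself.\<close>
      have "m > 0" using False zero_in_no_top_digit[OF k] by (cases m) auto
      then have q: "Suc q < n" using k Suc by (simp add: q_def)
      have "(k - 1) * ?f (Suc q) \<le> ?f n"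
      proof (cases "m mod k = k - 1")
        case True
        then have "n = k * Suc q" using m k Suc by simp
        then show ?thesis using card_no_top_digit_mult[OF k, of "Suc q"] by simp
      next
        case False
        with \<open>m \<notin> no_top_digit k\<close> have "q \<notin> no_top_digit k"
          using no_top_digit_iff q_def by blast
        \<comment> \<open>Here k * Suc q may exceed \<open>n\<close>, but \<open>q\<close> adds
          nothing to the count, so the block below k q suffices.\<close>
        then have "?f (Suc q) = ?f q" by (simp add: lessThan_Suc)
        moreover have "?f (k * q) \<le> ?f n" using m Suc by (intro f_mono) simp
        ultimately show ?thesis using card_no_top_digit_mult[OF k, of q] by simp
      qed
      then have "real ((k - 1) * ?f (Suc q)) \<le> real (?f n)"
        by (simp only: of_nat_le_iff)
      then have upper: "(real k - 1) * real (?f (Suc q)) \<le> real (?f n)"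
        using k by (simp only: of_nat_mult) (simp add: of_nat_diff)
      have "n \<le> k * Suc q"
        using dividend_less_times_div[of k m] k Suc by (simp add: q_def)
      then have "real n powr \<alpha> \<le> real (k * Suc q) powr \<alpha>"
        using \<alpha> by (intro powr_mono2) (simp_all del: of_nat_mult of_nat_Suc mult_Suc_right)
      also have "\<dots> = (real k - 1) * real (Suc q) powr \<alpha>"
        using k_powr by (simp add: powr_mult del: of_nat_Suc mult_Suc_right)
      also have "\<dots> \<le> (real k - 1) * real (?f (Suc q))"
        using less.IH[OF q] k by (intro mult_left_mono) (auto simp: \<alpha>_def)
      finally show ?thesis using upper by (simp add: \<alpha>_def)
    qed
  qed simp
qed

text \<open>Translation by 1 moves the members below \<open>n\<close> into {1..n} and preserves
  progressions.\<close>

lemma card_no_top_digit_le_r: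
  assumes "prime k"
  shows "card (no_top_digit k \<inter> {..<n}) \<le> r k n"
proof -
  define A where "A = (\<lambda>x. int x + 1) ` (no_top_digit k \<inter> {..<n})"
  have card: "card A = card (no_top_digit k \<inter> {..<n})"
    unfolding A_def by (intro card_image inj_onI) simp
  have k: "k > 0" using assms prime_gt_0_nat by blast
  have "ap_free k A"
    unfolding ap_free_def
  proof (intro notI, elim exE conjE)
    fix a d :: int
    assume d: "d \<ge> 1" and sub: "arith_prog k a d \<subseteq> A"
    have mem: "a + int i * d \<in> A" if "i < k" for i
      using that sub by (auto simp: arith_prog_def)
    from mem[OF k] obtain b where b: "a = int b + 1"
      by (auto simp: A_def)
    from d obtain e where e: "d = int e" "e > 0"
      by (metis int_one_le_iff_zero_less zero_less_imp_eq_int of_nat_0_less_iff)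
    obtain i where i: "i < k" "b + i * e \<notin> no_top_digit k"
      using no_top_digit_no_progression[OF assms e(2)] by blast
    from mem[OF i(1)] obtain x where x: "x \<in> no_top_digit k" "a + int i * d = int x + 1"
      by (auto simp: A_def)
    from x(2) have "int (b + i * e) = int x" by (simp add: b e)
    then have "b + i * e = x" by (simp only: of_nat_eq_iff)
    with x(1) i(2) show False by simp
  qed
  moreover have "A \<subseteq> {1..int n}" by (auto simp: A_def)
  ultimately have "card A \<le> r k n"
    unfolding r_def by (intro Max_ge finite_imageI) auto
  with card show ?thesis by simp
qed

theorem theorem3:
  "\<exists>c :: nat \<Rightarrow> real.
     (c \<longlongrightarrow> 1) (inf at_top (principal {k. prime k})) \<and>
     (\<forall>(n::nat) (k::nat). n \<ge> 2 \<longrightarrow> prime k \<longrightarrow>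
        real n powr (1 - c k / (real k * ln (real k))) < real (r k n))"
proof (intro exI conjI allI impI)
  \<comment> \<open>The first summand alone gives exactly the exponent log_k (k - 1); the second
    makes the inequality strict and vanishes in the limit.\<close>
  let ?c = "\<lambda>k::nat. real k * ln (real k / (real k - 1)) + 1 / real k"
  have "(?c \<longlongrightarrow> 1) at_top" by real_asymp
  then show "(?c \<longlongrightarrow> 1) (inf at_top (principal {k. prime k}))"
    by (rule tendsto_mono[OF inf_le1])
  fix n k :: nat
  assume n: "n \<ge> 2" and "prime k"
  then have k: "k \<ge> 2" using prime_ge_2_nat by blast
  have "1 - ?c k / (real k * ln (real k))
      = log (real k) (real k - 1) - 1 / (real k * (real k * ln (real k)))"
    using k by (simp add: ln_div log_def field_simps)
  also have "\<dots> < log (real k) (real k - 1)" using k by simp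
  finally have "real n powr (1 - ?c k / (real k * ln (real k)))
      < real n powr log (real k) (real k - 1)"
    using n by (intro powr_less_mono) auto
  also have "\<dots> \<le> real (card (no_top_digit k \<inter> {..<n}))"
    by (rule card_no_top_digit_ge[OF k])
  also have "\<dots> \<le> real (r k n)"
    using card_no_top_digit_le_r[OF \<open>prime k\<close>] by simp
  finally show "real n powr (1 - ?c k / (real k * ln (real k))) < real (r k n)" .
qed

end
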